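(* For every positive integer $k$ and every $\lambda\in\left(0,\frac1k\right)$ we have $$\Gamma_{\lambda}(k)=\frac{(k-1)!}{(1-\lambda)(1-2\lambda)\cdots(1-k\lambda)}.$$
   Context: For real $\lambda\in(0,\infty)$ and complex $s$ with $0<\operatorname{Re}(s)<\frac1\lambda$, the degenerate gamma function is defined by $$\Gamma_{\lambda}(s)=\int_0^{\infty}(1+\lambda t)^{-\frac1\lambda}\,t^{s-1}\,dt .$$ *)

theory Defs
  imports "HOL-Analysis.Analysis"
begin

(* The integral converges absolutely exactly for 0 < Re s < 1 / lam (with lam > 0);
   outside that domain the defined value carries no meaning. *)
definition degenerate_Gamma :: "real \<Rightarrow> complex \<Rightarrow> complex" where
  "degenerate_Gamma lam s =
     (LINT t:{0<..}|lborel.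
        complex_of_real ((1 + lam * t) powr (- 1 / lam)) * complex_of_real t powr (s - 1))"

end

theory Submission
  imports Defs
begin

text \<open>
  Consider more generally the integral of \<open>t ^ m * (1 + lam * t) powr (- a)\<close> over \<open>t > 0\<close>,
  with an exponent \<open>a > m + 1\<close> that is not tied to \<open>lam\<close>. Integration by parts lowers \<open>m\<close> and \<open>a\<close>
  by one simultaneously, and brings out the factor \<open>m / (lam * (a - 1))\<close>; the boundary terms vanish
  because \<open>a > m + 1\<close>. After \<open>m\<close> such steps the remaining integrand is a pure power of \<open>1 + lam * t\<close>,
  and the value is \<open>m!\<close> divided by the product of the \<open>lam * (a - j)\<close> for \<open>j = 1, \<dots>, m + 1\<close>.
  For \<open>a = 1 / lam\<close> and \<open>m = k - 1\<close> the factors \<open>lam * (a - j)\<close> become \<open>1 - j * lam\<close>, and the condition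
  \<open>a > m + 1\<close> becomes \<open>lam < 1 / k\<close>.

  The integration by parts is carried out on antiderivatives (\<open>beta_antiderivative_exists\<close>), so that no
  integrability has to be established along the way: the integrand is nonnegative, and one
  application of the fundamental theorem of calculus on the half-line yields both the integrability
  and the value.
\<close>

text \<open>
  The boundary term at infinity: \<open>t ^ n\<close> is at most \<open>(1 + lam * t) ^ n / lam ^ n\<close>, which
  leaves a negative power of \<open>1 + lam * t\<close>.
\<close>

lemma power_mult_powr_tendsto_0:
  fixes lam b :: real and n :: nat
  assumes "lam > 0" and "b > real n"
  shows "((\<lambda>t. t ^ n * (1 + lam * t) powr (- b)) \<longlongrightarrow> 0) at_top"
proof (rule tendsto_sandwich)
  show "\<forall>\<^sub>F t in at_top. 0 \<le> t ^ n * (1 + lam * t) powr (- b)"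
    using eventually_ge_at_top[of 0] by eventually_elim simp
  show "\<forall>\<^sub>F t in at_top.
          t ^ n * (1 + lam * t) powr (- b) \<le> (1 + lam * t) powr (real n - b) / lam ^ n"
    using eventually_ge_at_top[of 0]
  proof eventually_elim
    case (elim t)
    have pos: "1 + lam * t > 0"
      using elim assms by (simp add: add_pos_nonneg)
    have "(lam * t) ^ n * (1 + lam * t) powr (- b) \<le> (1 + lam * t) ^ n * (1 + lam * t) powr (- b)"
      using elim assms by (intro mult_right_mono power_mono) auto
    also have "\<dots> = (1 + lam * t) powr (real n - b)"
      using pos by (simp add: powr_diff powr_minus powr_realpow field_simps)
    finally show ?case
      using assms by (simp add: power_mult_distrib field_simps)
  qed
  have "filterlim (\<lambda>t. 1 + lam * t) at_top at_top"
    using assms(1)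
    by (intro filterlim_tendsto_add_at_top[OF tendsto_const]
        filterlim_tendsto_pos_mult_at_top[OF tendsto_const] filterlim_ident)
  then have "((\<lambda>t. (1 + lam * t) powr (real n - b)) \<longlongrightarrow> 0) at_top"
    using assms(2) by (intro tendsto_neg_powr) auto
  from tendsto_divide[OF this tendsto_const, of "lam ^ n"]
  show "((\<lambda>t. (1 + lam * t) powr (real n - b) / lam ^ n) \<longlongrightarrow> 0) at_top"
    using assms by simp
qed simp

lemma DERIV_one_plus_mult_powr:
  fixes lam a t :: real
  assumes "lam > 0" and "t \<ge> 0"
  shows "((\<lambda>t. (1 + lam * t) powr (1 - a)) has_real_derivative
           (1 - a) * lam * (1 + lam * t) powr (- a)) (at t)"
proof -
  have "1 + lam * t > 0"
    using assms by (simp add: add_pos_nonneg)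
  moreover have "((\<lambda>t. 1 + lam * t) has_real_derivative lam) (at t)"
    by (auto intro!: derivative_eq_intros)
  ultimately show ?thesis
    using DERIV_fun_powr[of "\<lambda>t. 1 + lam * t" lam t "1 - a"] by (simp add: mult_ac)
qed

text \<open>
  The induction needs \<open>a\<close> to be independent of \<open>lam\<close>: the antiderivative for \<open>m + 1\<close> and \<open>a\<close> is built
  from the one for \<open>m\<close> and \<open>a - 1\<close>, so a claim about \<open>a = 1 / lam\<close> alone would not be inductive. With
  the value 0 at the origin, the limit at infinity is the integral.
\<close>

lemma beta_antiderivative_exists:
  fixes lam a :: real and m :: nat
  assumes lam: "lam > 0" and "a > real m + 1"
  shows "\<exists>G. (\<forall>t\<ge>0. (G has_real_derivative t ^ m * (1 + lam * t) powr (- a)) (at t)) \<and>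
             G 0 = 0 \<and> (G \<longlongrightarrow> fact m / (\<Prod>j = 1..m + 1. lam * (a - real j))) at_top"
  using assms(2)
proof (induction m arbitrary: a)
  case 0
  define G where "G = (\<lambda>t. (1 - (1 + lam * t) powr (1 - a)) / (lam * (a - 1)))"
  have "(G has_real_derivative t ^ 0 * (1 + lam * t) powr (- a)) (at t)" if "t \<ge> 0" for t
  proof -
    have "(G has_real_derivative
            (0 - (1 - a) * lam * (1 + lam * t) powr (- a)) / (lam * (a - 1))) (at t)"
      unfolding G_def
      by (intro DERIV_cdivide DERIV_diff DERIV_const DERIV_one_plus_mult_powr lam that)
    then show ?thesis
      by (rule DERIV_cong) (use lam 0 in \<open>simp add: divide_simps, simp add: algebra_simps\<close>)
  qed
  moreover have "(G \<longlongrightarrow> fact 0 / (\<Prod>j = 1..0 + 1. lam * (a - real j))) at_top"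
  proof -
    have "((\<lambda>t. (1 + lam * t) powr (1 - a)) \<longlongrightarrow> 0) at_top"
      using power_mult_powr_tendsto_0[OF lam, of 0 "a - 1"] 0 by simp
    then have "(G \<longlongrightarrow> (1 - 0) / (lam * (a - 1))) at_top"
      unfolding G_def using lam 0 by (intro tendsto_intros) auto
    then show ?thesis by simp
  qed
  moreover have "G 0 = 0"
    by (simp add: G_def)
  ultimately show ?case by blast
next
  case (Suc m)
  have "a - 1 > real m + 1"
    using Suc.prems by simp
  from Suc.IH[OF this] obtain H where
    H: "\<And>t. t \<ge> 0 \<Longrightarrow> (H has_real_derivative t ^ m * (1 + lam * t) powr (- (a - 1))) (at t)"
       "H 0 = 0" "(H \<longlongrightarrow> fact m / (\<Prod>j = 1..m + 1. lam * (a - 1 - real j))) at_top"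
    by blast
  \<comment> \<open>Integration by parts: \<open>t ^ Suc m\<close> is differentiated, the power of \<open>1 + lam * t\<close> is integrated.\<close>
  define G where
    "G = (\<lambda>t. (real (Suc m) * H t - t ^ Suc m * (1 + lam * t) powr (1 - a)) / (lam * (a - 1)))"
  have "(G has_real_derivative t ^ Suc m * (1 + lam * t) powr (- a)) (at t)" if "t \<ge> 0" for t
  proof -
    have "(G has_real_derivative
            (real (Suc m) * (t ^ m * (1 + lam * t) powr (- (a - 1)))
              - (real (Suc m) * t ^ m * (1 + lam * t) powr (1 - a)
                 + (1 - a) * lam * (1 + lam * t) powr (- a) * t ^ Suc m)) / (lam * (a - 1))) (at t)"
      unfolding G_def
      by (intro DERIV_cdivide DERIV_diff DERIV_cmult H(1)[OF that] DERIV_mult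
          DERIV_one_plus_mult_powr lam that)
        (use DERIV_pow[of "Suc m" t] in simp)
    then show ?thesis
      by (rule DERIV_cong) (use lam Suc.prems in \<open>simp add: divide_simps, simp add: algebra_simps\<close>)
  qed
  moreover have "(G \<longlongrightarrow> fact (Suc m) / (\<Prod>j = 1..Suc m + 1. lam * (a - real j))) at_top"
  proof -
    have "((\<lambda>t. t ^ Suc m * (1 + lam * t) powr (1 - a)) \<longlongrightarrow> 0) at_top"
      using power_mult_powr_tendsto_0[OF lam, of "Suc m" "a - 1"] Suc.prems by simp
    then have "(G \<longlongrightarrow> (real (Suc m) * (fact m / (\<Prod>j = 1..m + 1. lam * (a - 1 - real j))) - 0)
                    / (lam * (a - 1))) at_top"
      unfolding G_def using lam Suc.prems by (intro tendsto_intros H(3)) auto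
    moreover have "(\<Prod>j = 1..Suc m + 1. lam * (a - real j))
                     = lam * (a - 1) * (\<Prod>j = 1..m + 1. lam * (a - 1 - real j))"
    proof -
      have "(\<Prod>j = 1..Suc m + 1. lam * (a - real j))
              = lam * (a - 1) * (\<Prod>j = Suc 1..Suc (m + 1). lam * (a - real j))"
        by (subst prod.atLeast_Suc_atMost) simp_all
      also have "(\<Prod>j = Suc 1..Suc (m + 1). lam * (a - real j))
                   = (\<Prod>j = 1..m + 1. lam * (a - 1 - real j))"
        by (subst prod.shift_bounds_cl_Suc_ivl) (simp add: algebra_simps)
      finally show ?thesis .
    qed
    ultimately show ?thesis
      by (simp only: fact_Suc diff_0_right times_divide_eq_right divide_divide_eq_left mult_ac)
  qed
  moreover have "G 0 = 0"
    by (simp add: G_def H(2))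
  ultimately show ?case by blast
qed

lemma set_integral_power_mult_powr:
  fixes lam a :: real and m :: nat
  assumes lam: "lam > 0" and a: "a > real m + 1"
  shows "(LINT t:{0<..}|lborel. t ^ m * (1 + lam * t) powr (- a))
           = fact m / (\<Prod>j = 1..m + 1. lam * (a - real j))"
proof -
  obtain G where
    deriv: "\<And>t. t \<ge> 0 \<Longrightarrow> (G has_real_derivative t ^ m * (1 + lam * t) powr (- a)) (at t)"
    and G0: "G 0 = 0"
    and lim: "(G \<longlongrightarrow> fact m / (\<Prod>j = 1..m + 1. lam * (a - real j))) at_top"
    using beta_antiderivative_exists[OF assms] by blast
  have "(G \<longlongrightarrow> G 0) (at_right 0)"
    using DERIV_isCont[OF deriv[of 0]] by (simp add: isCont_def filterlim_at_split)
  then have lim0: "(G \<longlongrightarrow> 0) (at_right 0)"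
    by (simp add: G0)
  have cont: "isCont (\<lambda>t. t ^ m * (1 + lam * t) powr (- a)) t" if "t > 0" for t
  proof -
    have "1 + lam * t > 0"
      using that lam by (simp add: add_pos_pos)
    then show ?thesis by (intro continuous_intros) auto
  qed
  have "(LBINT t=ereal 0..\<infinity>. t ^ m * (1 + lam * t) powr (- a))
          = fact m / (\<Prod>j = 1..m + 1. lam * (a - real j)) - 0"
  proof (rule interval_integral_FTC_nonneg(2))
    show "((G \<circ> real_of_ereal) \<longlongrightarrow> 0) (at_right (ereal 0))"
      using lim0 by (simp add: ereal_tendsto_simps)
    show "((G \<circ> real_of_ereal) \<longlongrightarrow> fact m / (\<Prod>j = 1..m + 1. lam * (a - real j))) (at_left \<infinity>)"
      using lim by (simp add: ereal_tendsto_simps)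
  qed (use deriv cont in \<open>auto intro!: AE_I2\<close>)
  then show ?thesis
    by (simp add: zero_ereal_def[symmetric] interval_lebesgue_integral_0_infty)
qed

theorem theorem2p3:
  fixes k :: nat and lam :: real
  assumes "k > 0" and "lam \<in> {0<..<1 / real k}"
  shows "degenerate_Gamma lam (of_nat k) =
           complex_of_real (fact (k - 1) / (\<Prod>j = 1..k. 1 - real j * lam))"
proof -
  from assms have lam: "lam > 0" and "lam < 1 / real k" by auto
  with assms(1) have a: "1 / lam > real (k - 1) + 1"
    by (simp add: field_simps of_nat_diff)
  have "degenerate_Gamma lam (of_nat k)
          = (LINT t:{0<..}|lborel. complex_of_real (t ^ (k - 1) * (1 + lam * t) powr (- (1 / lam))))"
    unfolding degenerate_Gamma_def
  proof (rule set_lebesgue_integral_cong)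
    have "complex_of_real t powr (of_nat k - 1) = complex_of_real (t ^ (k - 1))" if "t > 0" for t
      using that assms(1) powr_nat[of "complex_of_real t" "k - 1"] by (simp add: of_nat_diff)
    then show "\<forall>t. t \<in> {0<..} \<longrightarrow>
        complex_of_real ((1 + lam * t) powr (- 1 / lam)) * complex_of_real t powr (of_nat k - 1)
          = complex_of_real (t ^ (k - 1) * (1 + lam * t) powr (- (1 / lam)))"
      by (simp add: mult.commute)
  qed simp
  also have "\<dots> = complex_of_real
                    (LINT t:{0<..}|lborel. t ^ (k - 1) * (1 + lam * t) powr (- (1 / lam)))"
    by (rule set_integral_complex_of_real)
  also have "(LINT t:{0<..}|lborel. t ^ (k - 1) * (1 + lam * t) powr (- (1 / lam)))
               = fact (k - 1) / (\<Prod>j = 1..k - 1 + 1. lam * (1 / lam - real j))"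
    using lam a by (rule set_integral_power_mult_powr)
  also have "(\<Prod>j = 1..k - 1 + 1. lam * (1 / lam - real j)) = (\<Prod>j = 1..k. 1 - real j * lam)"
    using lam assms(1) by (intro prod.cong) (auto simp: field_simps)
  finally show ?thesis .
qed

end
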